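(* Let $R$ be a based ring, regarded as a based $R_{ad}$-bimodule, and let $R=\bigoplus_{a\in A} R_a$ be its decomposition into a direct sum of indecomposable based $R_{ad}$-subbimodules, with index set $A$ containing an element $1\in A$ such that $R_1=R_{ad}$. For $a\in A$ let $a^*\in A$ be the element such that $(R_a)^*=R_{a^*}$. Then there is a canonical group structure on the index set $A$ with the multiplication defined by the following property: for $a,b,c\in A$, $$ab=c \quad\text{if and only if}\quad X_aX_b\in R_c \text{ for all } X_a\in R_a,\ X_b\in R_b.$$ The identity of $A$ is $1$ and the inverse of $a\in A$ is $a^*$.
   Context: A based ring is a pair $(R,B)$ where $R$ is a ring with identity, free of finite rank as a $\mathbb{Z}$-module, and $B=\{X_i\}_{i\in\mathcal{I}}$ is a $\mathbb{Z}$-basis of $R$ (its elements are called basic) such that $X_iX_j=\sum_{k}c_{ij}^kX_k$ with all $c_{ij}^k$ non-negative integers, the identity $1$ belongs to $B$ (all based rings are unital), and there is an involution $i\mapsto i^*$ of $\mathcal{I}$ whose induced map $X=\sum a_iX_i\mapsto X^*=\sum a_iX_{i^*}$ satisfies $(XY,Z)=(X,ZY^* )=(Y,X^*Z)$ for all $X,Y,Z\in R$, where $(\sum a_iX_i,\sum b_iX_i)=\sum a_ib_i$. A based subring is a subring of $R$ spanned by a subset of $B$ that is itself a based ring with that basis. $R_{ad}$ is the minimal based subring of $R$ such that $X_iX_i^*\in R_{ad}$ for all $i\in\mathcal{I}$. A based $R_{ad}$-subbimodule of $R$ is the $\mathbb{Z}$-span of a subset of $B$ that is stable under left and right multiplication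 by $R_{ad}$; it is indecomposable if it is nonzero and is not a direct sum of two nonzero based subbimodules. The decomposition of $R$ into indecomposable based $R_{ad}$-subbimodules exists and is unique up to a permutation of $A$, and $R_{ad}$ is one of the components. For each $a\in A$, $(R_a)^*=\{X^*\mid X\in R_a\}$ is again one of the components. *)

theory Defs
  imports Complex_Main "HOL-Algebra.Group"
begin

definition zscale :: "int \<Rightarrow> 'a::ring_1 \<Rightarrow> 'a"
  where "zscale n x = of_int n * x"

global_interpretation zmod: module zscale
  by unfold_locales (simp_all add: zscale_def algebra_simps)

definition is_subring :: "'a::ring_1 set \<Rightarrow> bool"
  where "is_subring S \<longleftrightarrow>
    1 \<in> S \<and> (\<forall>x\<in>S. \<forall>y\<in>S. x - y \<in> S) \<and> (\<forall>x\<in>S. \<forall>y\<in>S. x * y \<in> S)"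

definition is_zbasis :: "'a::ring_1 set \<Rightarrow> 'a set \<Rightarrow> bool"
  where "is_zbasis S B \<longleftrightarrow> finite B \<and> zmod.independent B \<and> zmod.span B = S"

text \<open>
  The pairing and the map \<open>X \<mapsto> X\<^sup>*\<close> determined by a basis \<open>B\<close> and an involution \<open>star\<close> of \<open>B\<close>;
  \<open>zmod.representation B x b\<close> is the coefficient of \<open>b\<close> in \<open>x\<close>.
\<close>

definition zform :: "'a::ring_1 set \<Rightarrow> 'a \<Rightarrow> 'a \<Rightarrow> int"
  where "zform B x y = (\<Sum>b\<in>B. zmod.representation B x b * zmod.representation B y b)"

definition star_ext :: "'a::ring_1 set \<Rightarrow> ('a \<Rightarrow> 'a) \<Rightarrow> 'a \<Rightarrow> 'a"
  where "star_ext B star x = (\<Sum>b\<in>B. zscale (zmod.representation B x b) (star b))"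

text \<open>
  The basis is a set indexed by itself, so the involution of the index set is an involution of \<open>B\<close>;
  the values of \<open>star\<close> outside \<open>B\<close> are irrelevant.  The carrier \<open>S\<close> is a subring of an ambient ring,
  so that the same notion applies to a ring (\<open>S = UNIV\<close>) and to its subrings.
\<close>

definition based_ring_on :: "'a::ring_1 set \<Rightarrow> 'a set \<Rightarrow> ('a \<Rightarrow> 'a) \<Rightarrow> bool"
  where "based_ring_on S B star \<longleftrightarrow>
    is_subring S \<and>
    is_zbasis S B \<and>
    (\<forall>x\<in>B. \<forall>y\<in>B. \<forall>z\<in>B. zmod.representation B (x * y) z \<ge> 0) \<and>
    1 \<in> B \<and>
    (\<forall>x\<in>B. star x \<in> B \<and> star (star x) = x) \<and>
    (\<forall>X\<in>S. \<forall>Y\<in>S. \<forall>Z\<in>S.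
       zform B (X * Y) Z = zform B X (Z * star_ext B star Y) \<and>
       zform B (X * Y) Z = zform B Y (star_ext B star X * Z))"

definition based_ring :: "'a::ring_1 set \<Rightarrow> ('a \<Rightarrow> 'a) \<Rightarrow> bool"
  where "based_ring B star \<longleftrightarrow> based_ring_on UNIV B star"

definition based_subring :: "'a::ring_1 set \<Rightarrow> 'a set \<Rightarrow> bool"
  where "based_subring B S \<longleftrightarrow> (\<exists>C\<subseteq>B. \<exists>t. based_ring_on S C t)"

text \<open>Subsets are ordered by inclusion, so \<open>LEAST\<close> is the minimal based subring.\<close>

definition R_ad :: "'a::ring_1 set \<Rightarrow> ('a \<Rightarrow> 'a) \<Rightarrow> 'a set"
  where "R_ad B star = (LEAST S. based_subring B S \<and> (\<forall>x\<in>B. x * star x \<in> S))"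

definition based_subbimodule :: "'a::ring_1 set \<Rightarrow> ('a \<Rightarrow> 'a) \<Rightarrow> 'a set \<Rightarrow> bool"
  where "based_subbimodule B star M \<longleftrightarrow>
    (\<exists>C\<subseteq>B. M = zmod.span C) \<and>
    (\<forall>r\<in>R_ad B star. \<forall>m\<in>M. r * m \<in> M \<and> m * r \<in> M)"

definition indecomposable_subbimodule :: "'a::ring_1 set \<Rightarrow> ('a \<Rightarrow> 'a) \<Rightarrow> 'a set \<Rightarrow> bool"
  where "indecomposable_subbimodule B star M \<longleftrightarrow>
    based_subbimodule B star M \<and> M \<noteq> {0} \<and>
    \<not> (\<exists>M1 M2. based_subbimodule B star M1 \<and> M1 \<noteq> {0} \<and>
               based_subbimodule B star M2 \<and> M2 \<noteq> {0} \<and>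
               M1 \<inter> M2 = {0} \<and> M = {x + y | x y. x \<in> M1 \<and> y \<in> M2})"

text \<open>
  The index set is not assumed to be finite, so the unique decomposition of each element
  is required to have finite support.
\<close>

definition is_direct_sum :: "'i set \<Rightarrow> ('i \<Rightarrow> 'a::ring_1 set) \<Rightarrow> bool"
  where "is_direct_sum A N \<longleftrightarrow>
    (\<forall>x. \<exists>!f. (\<forall>a\<in>A. f a \<in> N a) \<and> (\<forall>a. a \<notin> A \<longrightarrow> f a = 0) \<and>
              finite {a. f a \<noteq> 0} \<and> x = (\<Sum>a | f a \<noteq> 0. f a))"

definition indecomposable_decomposition ::
    "'a::ring_1 set \<Rightarrow> ('a \<Rightarrow> 'a) \<Rightarrow> 'i set \<Rightarrow> ('i \<Rightarrow> 'a set) \<Rightarrow> bool"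
  where "indecomposable_decomposition B star A N \<longleftrightarrow>
    (\<forall>a\<in>A. indecomposable_subbimodule B star (N a)) \<and> is_direct_sum A N"

definition mult_by_components :: "('i \<Rightarrow> 'a::ring_1 set) \<Rightarrow> 'i monoid \<Rightarrow> bool"
  where "mult_by_components N G \<longleftrightarrow>
    (\<forall>a\<in>carrier G. \<forall>b\<in>carrier G. \<forall>c\<in>carrier G.
       a \<otimes>\<^bsub>G\<^esub> b = c \<longleftrightarrow> (\<forall>X\<in>N a. \<forall>Y\<in>N b. X * Y \<in> N c))"

end

theory Submission
  imports Defs
begin

text \<open>
  Only the supports of products matter.  Say that a basic element \<open>z\<close> belongs to \<open>xy\<close>, for basic
  \<open>x\<close> and \<open>y\<close>, if it occurs in the product \<open>xy\<close> with nonzero coefficient.  Since the structure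
  constants are non-negative, this set-valued product is associative, and the invariance of the
  pairing makes it reversible: \<open>z \<in> xy\<close> implies \<open>x \<in> z y\<^sup>*\<close> and \<open>y \<in> x\<^sup>* z\<close>.  The basic elements thus
  form what is known as a polygroup.  In this language \<open>R\<^sub>a\<^sub>d\<close> is the span of the residue \<open>D\<close>, the
  smallest subpolygroup that contains all \<open>x x\<^sup>*\<close>, and based \<open>R\<^sub>a\<^sub>d\<close>-subbimodules are the spans of the
  subsets closed under multiplication by \<open>D\<close> from both sides.

  Everything rests on one inclusion.  If \<open>w\<close> and \<open>z\<close> both belong to \<open>yx\<close>, then \<open>x \<in> y\<^sup>* w\<close>, so
  \<open>z \<in> y y\<^sup>* w\<close> and \<open>w z\<^sup>* \<subseteq> (w w\<^sup>*)(y y\<^sup>*) \<subseteq> D\<close> (\<open>quotient_of_constituents_in_residue\<close>).  It has two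
  consequences.  Since \<open>y (x x\<^sup>*) y\<^sup>* = (yx)(yx)\<^sup>*\<close> is made of such products \<open>w z\<^sup>*\<close>, and \<open>D\<close> is generated
  by the \<open>x x\<^sup>*\<close>, the set \<open>D\<close> is normal: \<open>y D y\<^sup>* \<subseteq> D\<close> (\<open>residue_normal\<close>).  So left and right cosets of
  \<open>D\<close> coincide.  And all members of one product \<open>yx\<close> lie in the same coset of \<open>D\<close>
  (\<open>same_coset_constituents\<close>), so the product of two cosets is a single coset and the cosets form
  a group, with identity \<open>D\<close> and with inverse induced by the involution (\<open>coset_group\<close>).

  The subsets closed under \<open>D\<close> are the unions of cosets, so indecomposable subbimodules are the
  spans of single cosets, and a direct sum decomposition of the ring into indecomposables lists
  each coset exactly once (\<open>indecomposable_decomposition_cosets\<close>).  The index set is therefore in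
  bijection with the group of cosets.  The defining property of the multiplication determines it,
  because it holds for \<open>c = ab\<close> and no other \<open>c\<close>.
\<close>

section \<open>Polygroups and their residue\<close>

text \<open>
  The set-valued product \<open>mul\<close> remembers of a based ring only which basic elements occur in
  a product of two basic elements.  The two laws of reversibility are what remains of the
  adjunctions \<open>(XY, Z) = (X, ZY\<^sup>*) = (Y, X\<^sup>*Z)\<close>.  All axioms speak of elements of \<open>P\<close>
  only, because basic elements form a proper subset of the ring.
\<close>

locale polygroup =
  fixes P :: "'a set" and mul :: "'a \<Rightarrow> 'a \<Rightarrow> 'a set" and one :: 'a and star :: "'a \<Rightarrow> 'a"
  assumes mul_in: "x \<in> P \<Longrightarrow> y \<in> P \<Longrightarrow> z \<in> mul x y \<Longrightarrow> z \<in> P"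
    and one_in [simp]: "one \<in> P"
    and star_in [simp]: "x \<in> P \<Longrightarrow> star x \<in> P"
    and star_star [simp]: "x \<in> P \<Longrightarrow> star (star x) = x"
    and mul_one_left [simp]: "x \<in> P \<Longrightarrow> mul one x = {x}"
    and mul_one_right [simp]: "x \<in> P \<Longrightarrow> mul x one = {x}"
    and mul_assoc: "\<lbrakk>x \<in> P; y \<in> P; z \<in> P\<rbrakk> \<Longrightarrow>
          (\<Union>w\<in>mul x y. mul w z) = (\<Union>v\<in>mul y z. mul x v)"
    and reverse_left: "\<lbrakk>x \<in> P; y \<in> P; z \<in> mul x y\<rbrakk> \<Longrightarrow> x \<in> mul z (star y)"
    and reverse_right: "\<lbrakk>x \<in> P; y \<in> P; z \<in> mul x y\<rbrakk> \<Longrightarrow> y \<in> mul (star x) z"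
begin

lemma mul_subset: "x \<in> P \<Longrightarrow> y \<in> P \<Longrightarrow> mul x y \<subseteq> P"
  using mul_in by blast

lemma reassoc_right:
  assumes "x \<in> P" "y \<in> P" "z \<in> P" "w \<in> mul x y" "u \<in> mul w z"
  obtains v where "v \<in> P" "v \<in> mul y z" "u \<in> mul x v"
proof -
  have "u \<in> (\<Union>v\<in>mul y z. mul x v)"
    using assms mul_assoc[of x y z] by blast
  then show thesis using that assms mul_in by blast
qed

lemma reassoc_left:
  assumes "x \<in> P" "y \<in> P" "z \<in> P" "v \<in> mul y z" "u \<in> mul x v"
  obtains w where "w \<in> P" "w \<in> mul x y" "u \<in> mul w z"
proof -
  have "u \<in> (\<Union>w\<in>mul x y. mul w z)"
    using assms mul_assoc[of x y z] by blast
  then show thesis using that assms mul_in by blast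
qed

lemma one_in_mul_star: "x \<in> P \<Longrightarrow> one \<in> mul x (star x)"
  using reverse_left[of one x x] by simp

lemma one_in_star_mul: "x \<in> P \<Longrightarrow> one \<in> mul (star x) x"
  using one_in_mul_star[of "star x"] by simp

text \<open>
  Three reversals: \<open>z \<in> xy\<close> gives \<open>y \<in> x\<^sup>* z\<close>, then \<open>x\<^sup>* \<in> y z\<^sup>*\<close>, then
  \<open>z\<^sup>* \<in> y\<^sup>* x\<^sup>*\<close>.
\<close>

lemma star_mul:
  assumes "x \<in> P" "y \<in> P" "z \<in> mul x y"
  shows "star z \<in> mul (star y) (star x)"
proof -
  have z: "z \<in> P" using assms mul_in by blast
  have "y \<in> mul (star x) z" using assms reverse_right by blast
  then have "star x \<in> mul y (star z)" using assms z reverse_left by simp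
  then show ?thesis using assms z reverse_right by simp
qed

text \<open>
  From \<open>y \<in> 1y\<close> and \<open>1 \<in> x\<^sup>* x\<close>, the element \<open>y\<close> lies in \<open>(x\<^sup>* x)y = x\<^sup>*(xy)\<close>, so \<open>xy\<close>
  cannot be empty.
\<close>

lemma mul_nonempty:
  assumes "x \<in> P" "y \<in> P"
  obtains z where "z \<in> P" "z \<in> mul x y"
proof -
  have "y \<in> mul one y" using assms by simp
  with assms one_in_star_mul[of x] obtain v where "v \<in> P" "v \<in> mul x y"
    by (meson reassoc_right star_in)
  then show thesis using that by blast
qed

definition subpolygroup :: "'a set \<Rightarrow> bool"
  where "subpolygroup C \<longleftrightarrow>
    C \<subseteq> P \<and> one \<in> C \<and> (\<forall>x\<in>C. star x \<in> C) \<and> (\<forall>x\<in>C. \<forall>y\<in>C. mul x y \<subseteq> C)"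

text \<open>
  The combinatorial shadow of \<open>R\<^sub>a\<^sub>d\<close>; in the polygroup of double cosets of a
  subgroup it consists of the double cosets inside the normal closure of that subgroup.
\<close>

definition residue :: "'a set"
  where "residue = \<Inter>{C. subpolygroup C \<and> (\<forall>x\<in>P. mul x (star x) \<subseteq> C)}"

lemma residue_minimal:
  "\<lbrakk>subpolygroup C; \<And>x. x \<in> P \<Longrightarrow> mul x (star x) \<subseteq> C\<rbrakk> \<Longrightarrow> residue \<subseteq> C"
  unfolding residue_def by blast

lemma mul_star_in_residue: "x \<in> P \<Longrightarrow> mul x (star x) \<subseteq> residue"
  unfolding residue_def by blast

lemma subpolygroup_Inter:
  assumes "\<C> \<noteq> {}" "\<And>C. C \<in> \<C> \<Longrightarrow> subpolygroup C"
  shows "subpolygroup (\<Inter>\<C>)"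
  unfolding subpolygroup_def
proof (intro conjI ballI)
  show "\<Inter>\<C> \<subseteq> P" using assms unfolding subpolygroup_def by (meson Inf_lower2 ex_in_conv)
  show "one \<in> \<Inter>\<C>" using assms unfolding subpolygroup_def by simp
  show "star x \<in> \<Inter>\<C>" if "x \<in> \<Inter>\<C>" for x
    using that assms(2) unfolding subpolygroup_def by simp
  show "mul x y \<subseteq> \<Inter>\<C>" if "x \<in> \<Inter>\<C>" "y \<in> \<Inter>\<C>" for x y
  proof (rule Inf_greatest)
    fix C assume "C \<in> \<C>"
    with that assms(2) show "mul x y \<subseteq> C" unfolding subpolygroup_def by (meson Inter_iff)
  qed
qed

lemma subpolygroup_carrier: "subpolygroup P"
  unfolding subpolygroup_def using mul_subset by auto

lemma residue_subset: "residue \<subseteq> P"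
  using residue_minimal[OF subpolygroup_carrier] mul_subset by simp

lemma residue_in: "d \<in> residue \<Longrightarrow> d \<in> P"
  using residue_subset by blast

lemma subpolygroup_residue: "subpolygroup residue"
  unfolding residue_def
proof (rule subpolygroup_Inter)
  have "P \<in> {C. subpolygroup C \<and> (\<forall>x\<in>P. mul x (star x) \<subseteq> C)}"
    using subpolygroup_carrier mul_subset by simp
  then show "{C. subpolygroup C \<and> (\<forall>x\<in>P. mul x (star x) \<subseteq> C)} \<noteq> {}" by blast
qed simp

lemma one_in_residue: "one \<in> residue"
  and star_in_residue: "d \<in> residue \<Longrightarrow> star d \<in> residue"
  and mul_in_residue: "d \<in> residue \<Longrightarrow> d' \<in> residue \<Longrightarrow> mul d d' \<subseteq> residue"
  using subpolygroup_residue unfolding subpolygroup_def by auto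

text \<open>
  The crucial inclusion: for \<open>w, z \<in> yx\<close> one has \<open>x \<in> y\<^sup>* w\<close>, hence \<open>z \<in> (y y\<^sup>*) w\<close>, and
  therefore \<open>w z\<^sup>* \<subseteq> (w w\<^sup>*)(y y\<^sup>*)\<close>.  The point is that \<open>w\<close> and \<open>z\<close> may be different, whereas
  the residue is only generated by products \<open>x x\<^sup>*\<close>.
\<close>

lemma quotient_of_constituents_in_residue:
  assumes yx: "y \<in> P" "x \<in> P" and w: "w \<in> mul y x" and z: "z \<in> mul y x"
  shows "mul w (star z) \<subseteq> residue"
proof
  fix v assume v: "v \<in> mul w (star z)"
  have P: "w \<in> P" "z \<in> P" using assms mul_in by blast+
  have "x \<in> mul (star y) w" using reverse_right yx w by blast
  then obtain p where p: "p \<in> P" "p \<in> mul y (star y)" "z \<in> mul p w"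
    using reassoc_left[of y "star y" w x z] yx z P by auto
  have "star z \<in> mul (star w) (star p)" using star_mul p P by blast
  then obtain q where q: "q \<in> P" "q \<in> mul w (star w)" "v \<in> mul q (star p)"
    using reassoc_left[of w "star w" "star p" "star z" v] v P p by auto
  have "p \<in> residue" "q \<in> residue" using p q yx P mul_star_in_residue by blast+
  then show "v \<in> residue" using q(3) mul_in_residue star_in_residue by blast
qed

text \<open>
  The residue is stable under conjugation: \<open>y d y\<^sup>*\<close> lies in it whenever \<open>d\<close> does.  This uses the
  minimality of the residue; a larger subpolygroup (such as a subgroup of a group that is
  not normal) need not have the property.  The elements \<open>d\<close> all of whose conjugates lie in the
  residue form a subpolygroup \<open>N\<close>.  It contains \<open>x x\<^sup>*\<close>, because \<open>y x x\<^sup>* y\<^sup>*\<close> consists of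
  products \<open>w z\<^sup>*\<close> with \<open>w, z \<in> yx\<close>, and so it contains the residue.
\<close>

lemma residue_normal:
  assumes "d \<in> residue" "y \<in> P" "u \<in> mul y d"
  shows "mul u (star y) \<subseteq> residue"
proof -
  define N where "N = {d \<in> P. \<forall>y\<in>P. \<forall>u\<in>mul y d. mul u (star y) \<subseteq> residue}"
  have N_D: "v \<in> residue"
    if "d \<in> N" "y \<in> P" "u \<in> mul y d" "v \<in> mul u (star y)" for d y u v
    using that unfolding N_def by blast
  have N_I: "d \<in> N"
    if "d \<in> P" "\<And>y u v. \<lbrakk>y \<in> P; u \<in> mul y d; v \<in> mul u (star y)\<rbrakk> \<Longrightarrow> v \<in> residue" for d
    using that unfolding N_def by blast
  have "subpolygroup N"
    unfolding subpolygroup_def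
  proof (intro conjI ballI subsetI)
    show "d \<in> N \<Longrightarrow> d \<in> P" for d unfolding N_def by blast
    show "one \<in> N" using mul_star_in_residue by (intro N_I) auto
  next
    fix d assume d: "d \<in> N"
    then have dP: "d \<in> P" unfolding N_def by blast
    have "v \<in> residue" if y: "y \<in> P" and u: "u \<in> mul y (star d)" and v: "v \<in> mul u (star y)" for y u v
    proof -
      have uP: "u \<in> P" using y dP u mul_in star_in by blast
      have vP: "v \<in> P" using y uP v mul_in star_in by blast
      have "star v \<in> mul y (star u)" "star u \<in> mul d (star y)"
        using star_mul[of u "star y" v] star_mul[of y "star d" u] u v y uP dP by auto
      then obtain w where "w \<in> P" "w \<in> mul y d" "star v \<in> mul w (star y)"
        using reassoc_left[of y d "star y" "star u" "star v"] y dP by auto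
      then have "star v \<in> residue" using N_D[OF d y] by blast
      then show ?thesis using star_in_residue[of "star v"] vP by simp
    qed
    then show "star d \<in> N" using dP by (intro N_I) auto
  next
    fix d d' g assume d: "d \<in> N" and d': "d' \<in> N" and g: "g \<in> mul d d'"
    have dP: "d \<in> P" "d' \<in> P" using d d' unfolding N_def by blast+
    then have gP: "g \<in> P" using g mul_in by blast
    have "v \<in> residue" if y: "y \<in> P" and u: "u \<in> mul y g" and v: "v \<in> mul u (star y)" for y u v
    proof -
      obtain w where w: "w \<in> P" "w \<in> mul y d" "u \<in> mul w d'"
        using reassoc_left[OF y dP g u] by blast
      obtain k where k: "k \<in> P" "k \<in> mul d' (star y)" "v \<in> mul w k"
        using reassoc_right[of w d' "star y" u v] w dP y v by auto
      \<comment> \<open>Insert \<open>1 \<in> y\<^sup>* y\<close> between the two factors, so that each is conjugated separately.\<close>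
      obtain a where a: "a \<in> P" "a \<in> mul w (star y)" "w \<in> mul a y"
        using reassoc_left[of w "star y" y one w] one_in_star_mul[OF y] w y by auto
      obtain m where m: "m \<in> P" "m \<in> mul y k" "v \<in> mul a m"
        using reassoc_right[of a y k w v] a k y by auto
      obtain n where n: "n \<in> P" "n \<in> mul y d'" "m \<in> mul n (star y)"
        using reassoc_left[of y d' "star y" k m] y dP k m by auto
      have "a \<in> residue" "m \<in> residue"
        using N_D[OF d y w(2) a(2)] N_D[OF d' y n(2,3)] .
      then show ?thesis using m mul_in_residue by blast
    qed
    then show "g \<in> N" using gP by (intro N_I)
  qed
  moreover have "mul x (star x) \<subseteq> N" if x: "x \<in> P" for x
  proof
    fix d assume d: "d \<in> mul x (star x)"
    then have dP: "d \<in> P" using x mul_in star_in by blast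
    have "v \<in> residue" if y: "y \<in> P" and u: "u \<in> mul y d" and v: "v \<in> mul u (star y)" for y u v
    proof -
      obtain w where w: "w \<in> P" "w \<in> mul y x" "u \<in> mul w (star x)"
        using reassoc_left[of y x "star x" d u] x y d u by auto
      obtain z where z: "z \<in> P" "z \<in> mul (star x) (star y)" "v \<in> mul w z"
        using reassoc_right[of w "star x" "star y" u v] w x y v by auto
      have "star z \<in> mul y x" using star_mul[of "star x" "star y" z] z x y by simp
      then show ?thesis
        using quotient_of_constituents_in_residue[OF y x w(2), of "star z"] z by auto
    qed
    then show "d \<in> N" using dP by (intro N_I)
  qed
  ultimately have "residue \<subseteq> N" by (rule residue_minimal)
  then show ?thesis using assms N_D by blast
qed

section \<open>The quotient of a polygroup by its residue\<close>

definition same_coset :: "'a \<Rightarrow> 'a \<Rightarrow> bool"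
  where "same_coset x y \<longleftrightarrow> x \<in> P \<and> (\<exists>d\<in>residue. y \<in> mul x d)"

lemma same_coset_in: "same_coset x y \<Longrightarrow> x \<in> P \<and> y \<in> P"
  unfolding same_coset_def using mul_in residue_in by blast

text \<open>
  Left and right cosets of the residue agree.  If \<open>y \<in> xd\<close>, then \<open>y \<in> y(x\<^sup>* x) = (y x\<^sup>*)x\<close>, so
  \<open>y \<in> ax\<close> for some \<open>a \<in> y x\<^sup>*\<close>, which lies in \<open>(xd)x\<^sup>*\<close> and hence in the residue by normality.
\<close>

lemma same_coset_left:
  "same_coset x y \<longleftrightarrow> x \<in> P \<and> (\<exists>d\<in>residue. y \<in> mul d x)"
proof (intro iffI conjI)
  assume xy: "same_coset x y"
  then show x: "x \<in> P" using same_coset_in by blast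
  have y: "y \<in> P" using xy same_coset_in by blast
  obtain d where d: "d \<in> residue" "y \<in> mul x d" using xy unfolding same_coset_def by blast
  obtain a where "a \<in> P" "a \<in> mul y (star x)" "y \<in> mul a x"
    using reassoc_left[of y "star x" x one y] one_in_star_mul[OF x] x y by auto
  then show "\<exists>d\<in>residue. y \<in> mul d x" using residue_normal[OF d(1) x d(2)] by blast
next
  assume "x \<in> P \<and> (\<exists>d\<in>residue. y \<in> mul d x)"
  then obtain d where x: "x \<in> P" and d: "d \<in> residue" "y \<in> mul d x" by blast
  have dP: "d \<in> P" using d residue_in by blast
  have y: "y \<in> P" using d x dP mul_in by blast
  obtain a where a: "a \<in> P" "a \<in> mul (star x) y" "y \<in> mul x a"
    using reassoc_right[of x "star x" y one y] one_in_mul_star[OF x] x y by auto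
  obtain c where c: "c \<in> P" "c \<in> mul (star x) d" "a \<in> mul c x"
    using reassoc_left[of "star x" d x y a] x dP d a by auto
  then have "a \<in> residue" using residue_normal[OF d(1), of "star x" c] x by auto
  then show "same_coset x y" unfolding same_coset_def using a x by blast
qed

lemma same_coset_refl: "x \<in> P \<Longrightarrow> same_coset x x"
  unfolding same_coset_def using one_in_residue by force

lemma same_coset_sym: "same_coset x y \<Longrightarrow> same_coset y x"
  unfolding same_coset_def
  by (meson mul_in residue_in reverse_left star_in_residue)

lemma same_coset_trans:
  assumes "same_coset x y" "same_coset y z" shows "same_coset x z"
proof -
  obtain d d' where d: "d \<in> residue" "y \<in> mul x d" "d' \<in> residue" "z \<in> mul y d'"
    using assms unfolding same_coset_def by blast
  have x: "x \<in> P" using assms same_coset_in by blast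
  obtain v where "v \<in> mul d d'" "z \<in> mul x v"
    using reassoc_right[of x d d' y z] d x residue_in by blast
  then show ?thesis unfolding same_coset_def using mul_in_residue d x by blast
qed

text \<open>
  All constituents of one product lie in one coset, which is why the quotient is
  single-valued and thus a group: for \<open>w, z \<in> xy\<close> the set \<open>z w\<^sup>*\<close> lies in the residue, and
  \<open>z \<in> z(w\<^sup>* w) = (z w\<^sup>*)w\<close>.
\<close>

lemma same_coset_constituents:
  assumes "x \<in> P" "y \<in> P" "w \<in> mul x y" "z \<in> mul x y"
  shows "same_coset w z"
proof -
  have P: "w \<in> P" "z \<in> P" using assms mul_in by blast+
  obtain a where "a \<in> mul z (star w)" "z \<in> mul a w"
    using reassoc_left[of z "star w" w one z] one_in_star_mul[of w] P by auto
  then show ?thesis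
    unfolding same_coset_left using quotient_of_constituents_in_residue[of x y z w] assms P by blast
qed

text \<open>
  Write \<open>x' \<in> dx\<close> on the left and \<open>y' \<in> yd'\<close> on the right, so that the residue elements stay on
  the outside of \<open>x'y' \<subseteq> d(xy)d'\<close> and can be absorbed into the coset of a constituent of \<open>xy\<close>.
\<close>

lemma same_coset_mul:
  assumes x: "same_coset x x'" and y: "same_coset y y'" and z: "z \<in> mul x y" and z': "z' \<in> mul x' y'"
  shows "same_coset z z'"
proof -
  have P: "x \<in> P" "x' \<in> P" "y \<in> P" "y' \<in> P" using x y same_coset_in by blast+
  obtain d where d: "d \<in> residue" "x' \<in> mul d x" using x unfolding same_coset_left by blast
  obtain d' where d': "d' \<in> residue" "y' \<in> mul y d'" using y unfolding same_coset_def by blast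
  have dP: "d \<in> P" "d' \<in> P" using d d' residue_in by blast+
  obtain t where t: "t \<in> P" "t \<in> mul x y'" "z' \<in> mul d t"
    using reassoc_right[of d x y' x' z'] P dP d z' by blast
  obtain w where w: "w \<in> P" "w \<in> mul x y" "t \<in> mul w d'"
    using reassoc_left[of x y d' y' t] P dP d' t by blast
  have "same_coset z w" using same_coset_constituents P z w by blast
  moreover have "same_coset w t" unfolding same_coset_def using w d' by blast
  moreover have "same_coset t z'" unfolding same_coset_left using t d by blast
  ultimately show ?thesis using same_coset_trans by blast
qed

text \<open>
  The cosets are named by an arbitrary labelling \<open>cls\<close>, so that the group lives on a given
  index set instead of on sets of elements.
\<close>

lemma coset_group:
  fixes cls :: "'a \<Rightarrow> 'i"
  assumes cls: "\<And>x y. \<lbrakk>x \<in> P; y \<in> P\<rbrakk> \<Longrightarrow> cls x = cls y \<longleftrightarrow> same_coset x y"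
  obtains G :: "'i monoid" where "group G" "carrier G = cls ` P" "\<one>\<^bsub>G\<^esub> = cls one"
    "\<And>x y z. \<lbrakk>x \<in> P; y \<in> P; z \<in> mul x y\<rbrakk> \<Longrightarrow> cls x \<otimes>\<^bsub>G\<^esub> cls y = cls z"
    "\<And>x. x \<in> P \<Longrightarrow> inv\<^bsub>G\<^esub> (cls x) = cls (star x)"
proof -
  define op where "op a b = (SOME c. \<exists>x\<in>P. \<exists>y\<in>P. \<exists>z\<in>mul x y. a = cls x \<and> b = cls y \<and> c = cls z)" for a b
  define G :: "'i monoid" where "G = \<lparr>carrier = cls ` P, monoid.mult = op, one = cls one\<rparr>"
  have G: "carrier G = cls ` P" "\<one>\<^bsub>G\<^esub> = cls one" by (simp_all add: G_def)
  have mulG: "cls x \<otimes>\<^bsub>G\<^esub> cls y = cls z" if x: "x \<in> P" and y: "y \<in> P" and z: "z \<in> mul x y" for x y z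
  proof -
    have "\<exists>c. \<exists>x'\<in>P. \<exists>y'\<in>P. \<exists>z'\<in>mul x' y'. cls x = cls x' \<and> cls y = cls y' \<and> c = cls z'"
      using x y z by blast
    from someI_ex[OF this] obtain x' y' z' where *: "x' \<in> P" "y' \<in> P" "z' \<in> mul x' y'"
      "cls x = cls x'" "cls y = cls y'" "op (cls x) (cls y) = cls z'"
      unfolding op_def by blast
    have "same_coset x x'" "same_coset y y'" using * x y cls by auto
    then have "same_coset z z'" using same_coset_mul z * by blast
    then have "cls z = cls z'" using cls same_coset_in by blast
    then show ?thesis using * by (simp add: G_def)
  qed
  have inverse: "cls (star x) \<otimes>\<^bsub>G\<^esub> cls x = \<one>\<^bsub>G\<^esub>" if "x \<in> P" for x
    using mulG[of "star x" x one] one_in_star_mul that by (simp add: G)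
  have "group G"
  proof (rule groupI)
    fix a b assume "a \<in> carrier G" "b \<in> carrier G"
    then obtain x y where x: "x \<in> P" "a = cls x" and y: "y \<in> P" "b = cls y" using G by auto
    obtain z where "z \<in> P" "z \<in> mul x y" using mul_nonempty x y by blast
    then show "a \<otimes>\<^bsub>G\<^esub> b \<in> carrier G" using mulG x y G by auto
  next
    show "\<one>\<^bsub>G\<^esub> \<in> carrier G" by (simp add: G)
  next
    fix a b c assume "a \<in> carrier G" "b \<in> carrier G" "c \<in> carrier G"
    then obtain x y z where xyz: "x \<in> P" "y \<in> P" "z \<in> P" and abc: "a = cls x" "b = cls y" "c = cls z"
      using G by auto
    obtain w where w: "w \<in> P" "w \<in> mul x y" using mul_nonempty xyz by blast
    obtain u where u: "u \<in> P" "u \<in> mul w z" using mul_nonempty xyz w by blast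
    obtain v where v: "v \<in> P" "v \<in> mul y z" "u \<in> mul x v"
      using reassoc_right[of x y z w u] xyz w u by blast
    show "a \<otimes>\<^bsub>G\<^esub> b \<otimes>\<^bsub>G\<^esub> c = a \<otimes>\<^bsub>G\<^esub> (b \<otimes>\<^bsub>G\<^esub> c)"
      using mulG[of x y w] mulG[of w z u] mulG[of y z v] mulG[of x v u] xyz w u v abc by simp
  next
    fix a assume "a \<in> carrier G"
    then obtain x where x: "x \<in> P" "a = cls x" using G by auto
    show "\<one>\<^bsub>G\<^esub> \<otimes>\<^bsub>G\<^esub> a = a" using mulG[of one x x] x by (simp add: G)
    show "\<exists>b\<in>carrier G. b \<otimes>\<^bsub>G\<^esub> a = \<one>\<^bsub>G\<^esub>" using inverse x G by (auto intro!: bexI[of _ "star x"])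
  qed
  moreover have "inv\<^bsub>G\<^esub> (cls x) = cls (star x)" if "x \<in> P" for x
    using group.inv_equality[OF \<open>group G\<close> inverse] that G by auto
  ultimately show thesis using that G mulG by blast
qed

text \<open>
  These are the subsets that span subbimodules; by \<open>same_coset_left\<close> they are exactly the
  unions of cosets, so the minimal nonempty ones are the cosets.
\<close>

definition residue_stable :: "'a set \<Rightarrow> bool"
  where "residue_stable C \<longleftrightarrow>
    C \<subseteq> P \<and> (\<forall>d\<in>residue. \<forall>x\<in>C. mul d x \<subseteq> C \<and> mul x d \<subseteq> C)"

lemma residue_stable_iff:
  "residue_stable C \<longleftrightarrow> C \<subseteq> P \<and> (\<forall>x\<in>C. \<forall>y. same_coset x y \<longrightarrow> y \<in> C)"
  unfolding residue_stable_def
proof (intro conj_cong refl)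
  assume C: "C \<subseteq> P"
  have "(\<forall>d\<in>residue. mul d x \<subseteq> C \<and> mul x d \<subseteq> C) \<longleftrightarrow> (\<forall>y. same_coset x y \<longrightarrow> y \<in> C)"
    if "x \<in> C" for x
  proof -
    have "x \<in> P" using that C by blast
    then have "same_coset x y \<longleftrightarrow> (\<exists>d\<in>residue. y \<in> mul x d)"
      and "same_coset x y \<longleftrightarrow> (\<exists>d\<in>residue. y \<in> mul d x)" for y
      using same_coset_def[of x y] same_coset_left[of x y] by auto
    then show ?thesis by blast
  qed
  then show "(\<forall>d\<in>residue. \<forall>x\<in>C. mul d x \<subseteq> C \<and> mul x d \<subseteq> C) \<longleftrightarrow>
      (\<forall>x\<in>C. \<forall>y. same_coset x y \<longrightarrow> y \<in> C)" by blast
qed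

lemma residue_stable_coset: "x \<in> P \<Longrightarrow> residue_stable {y. same_coset x y}"
  unfolding residue_stable_iff using same_coset_in same_coset_trans by blast

lemma residue_stable_diff:
  "residue_stable C \<Longrightarrow> residue_stable C' \<Longrightarrow> residue_stable (C - C')"
  unfolding residue_stable_iff using same_coset_sym by blast

end


section \<open>Basic elements of a based ring form a polygroup\<close>

lemma span_mult:
  fixes C D E :: "'a::ring_1 set"
  assumes "\<And>x y. x \<in> C \<Longrightarrow> y \<in> D \<Longrightarrow> x * y \<in> zmod.span E"
    and "X \<in> zmod.span C" "Y \<in> zmod.span D"
  shows "X * Y \<in> zmod.span E"
proof -
  have *: "x * Y \<in> zmod.span E" if "x \<in> C" for x
    using \<open>Y \<in> zmod.span D\<close>
  proof (induction rule: zmod.span_induct_alt)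
    case base
    show ?case by (simp add: zmod.span_zero)
  next
    case (step c y z)
    have "x * (zscale c y + z) = zscale c (x * y) + x * z"
      by (simp add: zscale_def distrib_left) (metis mult.assoc mult_of_int_commute)
    then show ?case using step assms(1)[OF that] by (simp add: zmod.span_add zmod.span_scale)
  qed
  show ?thesis
    using \<open>X \<in> zmod.span C\<close>
  proof (induction rule: zmod.span_induct_alt)
    case base
    show ?case by (simp add: zmod.span_zero)
  next
    case (step c x z)
    have "(zscale c x + z) * Y = zscale c (x * Y) + z * Y"
      by (simp add: zscale_def distrib_right mult.assoc)
    then show ?case using step * by (simp add: zmod.span_add zmod.span_scale)
  qed
qed

lemma zform_basis:
  assumes "finite B" "zmod.independent B" "b \<in> B"
  shows "zform B b y = zmod.representation B y b"
proof -
  have "zform B b y = (\<Sum>c\<in>B. if c = b then zmod.representation B y c else 0)"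
    unfolding zform_def by (rule sum.cong) (simp_all add: zmod.representation_basis assms)
  then show ?thesis using assms by simp
qed

lemma star_ext_basis:
  assumes "finite B" "zmod.independent B" "b \<in> B"
  shows "star_ext B star b = star b"
proof -
  have "star_ext B star b = (\<Sum>c\<in>B. if c = b then star c else 0)"
    unfolding star_ext_def
    by (rule sum.cong) (simp_all add: zmod.representation_basis assms zscale_def)
  then show ?thesis using assms by simp
qed

lemma zform_commute: "zform B x y = zform B y x"
  unfolding zform_def by (simp add: mult.commute)

locale based =
  fixes B :: "'a::ring_1 set" and star :: "'a \<Rightarrow> 'a"
  assumes based_ring: "based_ring B star"
begin

abbreviation coeff :: "'a \<Rightarrow> 'a \<Rightarrow> int"
  where "coeff \<equiv> zmod.representation B"

definition supp :: "'a \<Rightarrow> 'a set"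
  where "supp x = {b. coeff x b \<noteq> 0}"

lemma based_ring_on: "based_ring_on UNIV B star"
  using based_ring by (simp add: based_ring_def)

lemma finite_basis: "finite B" and independent_basis: "zmod.independent B"
  and in_span_basis: "x \<in> zmod.span B"
  using based_ring_on by (auto simp: based_ring_on_def is_zbasis_def)

lemma coeff_nonneg: "\<lbrakk>x \<in> B; y \<in> B\<rbrakk> \<Longrightarrow> coeff (x * y) z \<ge> 0"
proof (cases "z \<in> B")
  case False
  then have "coeff (x * y) z = 0" using zmod.representation_ne_zero by blast
  then show ?thesis by simp
qed (use based_ring_on in \<open>auto simp: based_ring_on_def\<close>)

lemma one_in_basis: "1 \<in> B"
  and star_in_basis: "x \<in> B \<Longrightarrow> star x \<in> B"
  and star_involution: "x \<in> B \<Longrightarrow> star (star x) = x"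
  using based_ring_on by (auto simp: based_ring_on_def)

lemma zform_adjoint:
  "zform B (X * Y) Z = zform B X (Z * star_ext B star Y)"
  "zform B (X * Y) Z = zform B Y (star_ext B star X * Z)"
  using based_ring_on unfolding based_ring_on_def by blast+

lemma coeff_basis: "b \<in> B \<Longrightarrow> coeff b c = (if c = b then 1 else 0)"
  by (simp add: zmod.representation_basis[OF independent_basis])

lemma supp_subset: "supp x \<subseteq> B"
  unfolding supp_def using zmod.representation_ne_zero by blast

lemma supp_basis: "b \<in> B \<Longrightarrow> supp b = {b}"
  by (auto simp: supp_def coeff_basis)

lemma in_span_iff_supp: "C \<subseteq> B \<Longrightarrow> x \<in> zmod.span C \<longleftrightarrow> supp x \<subseteq> C"
proof
  assume C: "C \<subseteq> B" and x: "x \<in> zmod.span C"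
  have "coeff x = zmod.representation C x"
    by (rule zmod.representation_extend[OF independent_basis x C])
  then show "supp x \<subseteq> C"
    unfolding supp_def using zmod.representation_ne_zero by auto
next
  assume "supp x \<subseteq> C"
  moreover have "(\<Sum>b\<in>supp x. zscale (coeff x b) b) = x"
    unfolding supp_def
    by (rule zmod.sum_nonzero_representation_eq[OF independent_basis in_span_basis])
  ultimately show "x \<in> zmod.span C"
    by (metis (no_types, lifting) subsetD zmod.span_base zmod.span_scale zmod.span_sum)
qed

lemma span_subset_iff: "C \<subseteq> B \<Longrightarrow> D \<subseteq> B \<Longrightarrow> zmod.span C \<subseteq> zmod.span D \<longleftrightarrow> C \<subseteq> D"
  by (metis in_span_iff_supp order_trans singletonI subsetI subset_iff supp_basis zmod.span_base zmod.span_mono)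

lemma span_eq_iff: "C \<subseteq> B \<Longrightarrow> D \<subseteq> B \<Longrightarrow> zmod.span C = zmod.span D \<longleftrightarrow> C = D"
  by (metis span_subset_iff subset_antisym order_refl)

text \<open>
  The adjunction for the pairing, evaluated on basic elements: the coefficient of \<open>z\<close> in \<open>xy\<close> is
  that of \<open>x\<close> in \<open>z y\<^sup>*\<close> and that of \<open>y\<close> in \<open>x\<^sup>* z\<close>.
\<close>

lemma coeff_reverse:
  assumes "x \<in> B" "y \<in> B" "z \<in> B"
  shows "coeff (z * star y) x = coeff (x * y) z" "coeff (star x * z) y = coeff (x * y) z"
  using zform_adjoint[of x y z] zform_commute[of B "x * y" z] assms
  by (simp_all add: zform_basis star_ext_basis finite_basis independent_basis)

lemma coeff_mult_right:
  "coeff (x * y) u = (\<Sum>w\<in>B. coeff x w * coeff (w * y) u)"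
proof -
  have "x * y = (\<Sum>w\<in>B. zscale (coeff x w) w) * y"
    using zmod.sum_representation_eq[OF independent_basis in_span_basis finite_basis] by simp
  also have "\<dots> = (\<Sum>w\<in>B. zscale (coeff x w) (w * y))"
    by (simp add: sum_distrib_right zscale_def mult.assoc)
  finally show ?thesis
    by (simp add: zmod.representation_sum[OF independent_basis in_span_basis]
        zmod.representation_scale[OF independent_basis in_span_basis])
qed

lemma coeff_mult_left:
  "coeff (x * y) u = (\<Sum>v\<in>B. coeff y v * coeff (x * v) u)"
proof -
  have "x * y = x * (\<Sum>v\<in>B. zscale (coeff y v) v)"
    using zmod.sum_representation_eq[OF independent_basis in_span_basis finite_basis] by simp
  also have "\<dots> = (\<Sum>v\<in>B. zscale (coeff y v) (x * v))"
    by (simp add: sum_distrib_left zscale_def) (metis mult.assoc mult_of_int_commute)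
  finally show ?thesis
    by (simp add: zmod.representation_sum[OF independent_basis in_span_basis]
        zmod.representation_scale[OF independent_basis in_span_basis])
qed

text \<open>
  Non-negative structure constants cannot cancel, so the support of a triple product is the
  union of the supports obtained from either bracketing; this yields associativity of the
  set-valued product.
\<close>

lemma supp_mult:
  assumes x: "x \<in> B" and y: "y \<in> B" and z: "z \<in> B"
  shows "supp (x * y * z) = (\<Union>w\<in>supp (x * y). supp (w * z))"
    and "supp (x * y * z) = (\<Union>v\<in>supp (y * z). supp (x * v))"
proof -
  have "coeff (x * y * z) u \<noteq> 0 \<longleftrightarrow> (\<exists>w\<in>B. coeff (x * y) w * coeff (w * z) u \<noteq> 0)" for u
    unfolding coeff_mult_right[of "x * y" z]
    by (subst sum_nonneg_eq_0_iff[OF finite_basis]) (auto simp: coeff_nonneg x y z)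
  then show "supp (x * y * z) = (\<Union>w\<in>supp (x * y). supp (w * z))"
    using supp_subset[of "x * y"] unfolding supp_def by auto
  have "coeff (x * (y * z)) u \<noteq> 0 \<longleftrightarrow> (\<exists>v\<in>B. coeff (y * z) v * coeff (x * v) u \<noteq> 0)" for u
    unfolding coeff_mult_left[of x "y * z"]
    by (subst sum_nonneg_eq_0_iff[OF finite_basis]) (auto simp: coeff_nonneg x y z)
  then show "supp (x * y * z) = (\<Union>v\<in>supp (y * z). supp (x * v))"
    using supp_subset[of "y * z"] unfolding supp_def by (auto simp: mult.assoc)
qed

sublocale polygroup B "\<lambda>x y. supp (x * y)" 1 star
proof
  fix x y z assume x: "x \<in> B" and y: "y \<in> B"
  show "supp (1 * x) = {x}" "supp (x * 1) = {x}" using supp_basis x by simp_all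
  show "(\<Union>w\<in>supp (x * y). supp (w * z)) = (\<Union>v\<in>supp (y * z). supp (x * v))" if "z \<in> B"
    using supp_mult[OF x y that] by simp
  assume z: "z \<in> supp (x * y)"
  then show "z \<in> B" using supp_subset by blast
  then show "x \<in> supp (z * star y)" "y \<in> supp (star x * z)"
    using z coeff_reverse x y by (simp_all add: supp_def)
qed (simp_all add: one_in_basis star_in_basis star_involution supp_basis)

section \<open>Based subrings and subbimodules as spans\<close>

lemma mult_in_span_iff:
  assumes "C \<subseteq> B" "D \<subseteq> B" "E \<subseteq> B"
  shows "(\<forall>X\<in>zmod.span C. \<forall>Y\<in>zmod.span D. X * Y \<in> zmod.span E) \<longleftrightarrow>
         (\<forall>x\<in>C. \<forall>y\<in>D. supp (x * y) \<subseteq> E)"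
proof
  assume "\<forall>X\<in>zmod.span C. \<forall>Y\<in>zmod.span D. X * Y \<in> zmod.span E"
  then show "\<forall>x\<in>C. \<forall>y\<in>D. supp (x * y) \<subseteq> E"
    unfolding in_span_iff_supp[OF assms(3)] using zmod.span_base by blast
next
  assume "\<forall>x\<in>C. \<forall>y\<in>D. supp (x * y) \<subseteq> E"
  then show "\<forall>X\<in>zmod.span C. \<forall>Y\<in>zmod.span D. X * Y \<in> zmod.span E"
    using span_mult[of C D E] by (simp add: in_span_iff_supp[OF assms(3)])
qed

lemma is_subring_span_iff:
  assumes C: "C \<subseteq> B"
  shows "is_subring (zmod.span C) \<longleftrightarrow> 1 \<in> C \<and> (\<forall>x\<in>C. \<forall>y\<in>C. supp (x * y) \<subseteq> C)"
  unfolding is_subring_def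
  using mult_in_span_iff[OF C C C] in_span_iff_supp[OF C, of 1] supp_basis[OF one_in_basis]
  by (auto simp: zmod.span_diff)

lemma restrict_basis:
  assumes C: "C \<subseteq> B"
  shows "x \<in> zmod.span C \<Longrightarrow> zmod.representation C x = coeff x"
    and "x \<in> zmod.span C \<Longrightarrow> y \<in> zmod.span C \<Longrightarrow> zform C x y = zform B x y"
    and "x \<in> zmod.span C \<Longrightarrow> star_ext C star x = star_ext B star x"
proof -
  show rep: "zmod.representation C x = coeff x" if "x \<in> zmod.span C" for x
    using zmod.representation_extend[OF independent_basis that C] by simp
  have 0: "coeff x b = 0" if "x \<in> zmod.span C" "b \<in> B - C" for x b
    using that in_span_iff_supp[OF C] unfolding supp_def by blast
  show "zform C x y = zform B x y" if "x \<in> zmod.span C" "y \<in> zmod.span C"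
    unfolding zform_def rep[OF that(1)] rep[OF that(2)]
    by (rule sum.mono_neutral_left[OF finite_basis C]) (use 0[OF that(1)] in simp)
  show "star_ext C star x = star_ext B star x" if "x \<in> zmod.span C"
    unfolding star_ext_def rep[OF that]
    by (rule sum.mono_neutral_left[OF finite_basis C]) (use 0[OF that(1)] in simp)
qed

lemma star_ext_in_span:
  assumes "\<And>x. x \<in> C \<Longrightarrow> star x \<in> D" and "C \<subseteq> B" and X: "X \<in> zmod.span C"
  shows "star_ext B star X \<in> zmod.span D"
proof -
  have "star_ext C star X \<in> zmod.span D"
    unfolding star_ext_def using assms(1) by (intro zmod.span_sum zmod.span_scale zmod.span_base)
  then show ?thesis using restrict_basis(3)[OF assms(2) X] by simp
qed

lemma based_ring_on_span_subpolygroup: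
  assumes "subpolygroup C"
  shows "based_ring_on (zmod.span C) C star"
proof -
  have C: "C \<subseteq> B" "1 \<in> C" "\<And>x. x \<in> C \<Longrightarrow> star x \<in> C" "\<And>x y. x \<in> C \<Longrightarrow> y \<in> C \<Longrightarrow> supp (x * y) \<subseteq> C"
    using assms by (auto simp: subpolygroup_def)
  have ring: "is_subring (zmod.span C)" using C(2,4) by (simp add: is_subring_span_iff[OF C(1)])
  then have mult: "X * Y \<in> zmod.span C" if "X \<in> zmod.span C" "Y \<in> zmod.span C" for X Y
    using that by (simp add: is_subring_def)
  have basis: "is_zbasis (zmod.span C) C"
    using finite_subset[OF C(1) finite_basis] zmod.independent_mono[OF independent_basis C(1)]
    by (simp add: is_zbasis_def)
  have nonneg: "zmod.representation C (x * y) z \<ge> 0" if "x \<in> C" "y \<in> C" for x y z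
  proof -
    have "x * y \<in> zmod.span C" using that by (intro mult zmod.span_base)
    then show ?thesis using restrict_basis(1)[OF C(1)] coeff_nonneg[of x y z] that C(1) by auto
  qed
  have star: "star_ext B star X \<in> zmod.span C" if "X \<in> zmod.span C" for X
    by (rule star_ext_in_span[OF C(3) C(1) that])
  have adj: "zform C (X * Y) Z = zform C X (Z * star_ext C star Y) \<and>
        zform C (X * Y) Z = zform C Y (star_ext C star X * Z)"
    if "X \<in> zmod.span C" "Y \<in> zmod.span C" "Z \<in> zmod.span C" for X Y Z
    using that mult star zform_adjoint[of X Y Z] restrict_basis(2,3)[OF C(1)] by simp
  have inv: "star x \<in> C \<and> star (star x) = x" if "x \<in> C" for x
    using C(1,3) that star_involution by blast
  show ?thesis
    unfolding based_ring_on_def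
    by (intro conjI ballI ring basis nonneg C(2) inv[THEN conjunct1] inv[THEN conjunct2]
        adj[THEN conjunct1] adj[THEN conjunct2])
qed

text \<open>
  A based subring is allowed its own involution \<open>t\<close>, but that is determined by the ring: both
  \<open>t\<close> and \<open>star\<close> send \<open>y\<close> to the only basic element whose product with \<open>y\<close> contains \<open>1\<close>.
  Concretely, the coefficient of \<open>1\<close> in \<open>t(y) y\<close> is \<open>(t(y), t(y)) = 1\<close> in the subring and
  \<open>(t(y), y\<^sup>*)\<close> in the whole ring.
\<close>

lemma based_ring_on_span_involution:
  assumes C: "C \<subseteq> B" and "based_ring_on (zmod.span C) C t" and y: "y \<in> C"
  shows "star y = t y"
proof -
  have fin: "finite C" and ind: "zmod.independent C" and ring: "is_subring (zmod.span C)"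
    and t: "t y \<in> C"
    and adj: "\<And>X Y Z. \<lbrakk>X \<in> zmod.span C; Y \<in> zmod.span C; Z \<in> zmod.span C\<rbrakk> \<Longrightarrow>
               zform C (X * Y) Z = zform C X (Z * star_ext C t Y)"
    using assms unfolding based_ring_on_def is_zbasis_def by blast+
  have span: "y \<in> zmod.span C" "t y \<in> zmod.span C" using y t zmod.span_base by blast+
  then have span': "1 \<in> zmod.span C" "t y * y \<in> zmod.span C" using ring by (auto simp: is_subring_def)
  have yB: "y \<in> B" "t y \<in> B" using y t C by blast+
  have "zform C (t y * y) 1 = zform C (t y) (t y)"
    using adj[OF span(2,1) span'(1)] star_ext_basis[OF fin ind y, of t] by simp
  then have "zform C (t y * y) 1 = 1"
    using zform_basis[OF fin ind t] zmod.representation_basis[OF ind t] by simp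
  moreover have "zform B (t y * y) 1 = zform B (t y) (star y)"
    using zform_adjoint(1)[of "t y" y 1] star_ext_basis[OF finite_basis independent_basis yB(1), of star]
    by simp
  ultimately have "coeff (star y) (t y) = 1"
    using zform_basis[OF finite_basis independent_basis yB(2)] restrict_basis(2)[OF C span'(2,1)] by simp
  then show ?thesis
    using coeff_basis[OF star_in_basis[OF yB(1)]] by (simp split: if_splits)
qed

lemma based_subring_iff:
  "based_subring B S \<longleftrightarrow> (\<exists>C. subpolygroup C \<and> S = zmod.span C)"
proof
  assume "based_subring B S"
  then obtain C t where C: "C \<subseteq> B" and on: "based_ring_on S C t"
    unfolding based_subring_def by blast
  have S: "S = zmod.span C" using on by (simp add: based_ring_on_def is_zbasis_def)
  have "star x \<in> C" if "x \<in> C" for x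
    using based_ring_on_span_involution[OF C on[unfolded S] that] on that
    by (simp add: based_ring_on_def)
  moreover have "1 \<in> C \<and> (\<forall>x\<in>C. \<forall>y\<in>C. supp (x * y) \<subseteq> C)"
    using is_subring_span_iff[OF C] on S by (simp add: based_ring_on_def)
  ultimately have "subpolygroup C" using C by (simp add: subpolygroup_def)
  then show "\<exists>C. subpolygroup C \<and> S = zmod.span C" using S by blast
next
  assume "\<exists>C. subpolygroup C \<and> S = zmod.span C"
  then obtain C where "subpolygroup C" "S = zmod.span C" by blast
  then have "C \<subseteq> B" "based_ring_on S C star"
    using based_ring_on_span_subpolygroup by (auto simp: subpolygroup_def)
  then show "based_subring B S" unfolding based_subring_def by blast
qed

text \<open>
  Based subrings are ordered like the subpolygroups that span them, and those are closed under
  intersection; this is why a least based subring with the required elements exists.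
\<close>

lemma R_ad_eq_span_residue: "R_ad B star = zmod.span residue"
  unfolding R_ad_def
proof (rule Least_equality)
  have "x * star x \<in> zmod.span residue" if "x \<in> B" for x
    using mul_star_in_residue[OF that] by (simp add: in_span_iff_supp[OF residue_subset])
  then show "based_subring B (zmod.span residue) \<and> (\<forall>x\<in>B. x * star x \<in> zmod.span residue)"
    using subpolygroup_residue by (auto simp: based_subring_iff)
next
  fix S assume S: "based_subring B S \<and> (\<forall>x\<in>B. x * star x \<in> S)"
  then obtain C where C: "subpolygroup C" "S = zmod.span C" by (auto simp: based_subring_iff)
  then have "C \<subseteq> B" by (simp add: subpolygroup_def)
  then have "supp (x * star x) \<subseteq> C" if "x \<in> B" for x
    using S that unfolding C(2) in_span_iff_supp[OF \<open>C \<subseteq> B\<close>] by blast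
  then have "residue \<subseteq> C" by (rule residue_minimal[OF C(1)])
  then show "zmod.span residue \<subseteq> S" unfolding C(2) by (rule zmod.span_mono)
qed

lemma based_subbimodule_iff:
  "based_subbimodule B star M \<longleftrightarrow> (\<exists>C. residue_stable C \<and> M = zmod.span C)"
proof -
  note D = residue_subset
  have split: "(\<forall>r\<in>X. \<forall>m\<in>Y. p r m \<and> q m r) \<longleftrightarrow>
      (\<forall>r\<in>X. \<forall>m\<in>Y. p r m) \<and> (\<forall>m\<in>Y. \<forall>r\<in>X. q m r)" for X Y :: "'a set" and p q
    by blast
  have stable: "(\<forall>r\<in>zmod.span residue. \<forall>m\<in>zmod.span C. r * m \<in> zmod.span C \<and> m * r \<in> zmod.span C)
        \<longleftrightarrow> residue_stable C" (is "?L \<longleftrightarrow> _") if C: "C \<subseteq> B" for C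
  proof -
    have "?L \<longleftrightarrow> (\<forall>r\<in>zmod.span residue. \<forall>m\<in>zmod.span C. r * m \<in> zmod.span C) \<and>
        (\<forall>m\<in>zmod.span C. \<forall>r\<in>zmod.span residue. m * r \<in> zmod.span C)" by (rule split)
    also have "\<dots> \<longleftrightarrow> (\<forall>d\<in>residue. \<forall>x\<in>C. supp (d * x) \<subseteq> C) \<and>
        (\<forall>x\<in>C. \<forall>d\<in>residue. supp (x * d) \<subseteq> C)"
      unfolding mult_in_span_iff[OF D C C] mult_in_span_iff[OF C D C] ..
    also have "\<dots> \<longleftrightarrow> residue_stable C"
      unfolding residue_stable_def split using C by simp
    finally show ?thesis .
  qed
  show ?thesis
  proof
    assume "based_subbimodule B star M"
    then obtain C where "C \<subseteq> B" "M = zmod.span C"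
      "\<forall>r\<in>zmod.span residue. \<forall>m\<in>M. r * m \<in> M \<and> m * r \<in> M"
      unfolding based_subbimodule_def R_ad_eq_span_residue by auto
    then show "\<exists>C. residue_stable C \<and> M = zmod.span C" using stable[of C] by blast
  next
    assume "\<exists>C. residue_stable C \<and> M = zmod.span C"
    then obtain C where C: "residue_stable C" "M = zmod.span C" by auto
    then have "C \<subseteq> B" by (simp add: residue_stable_def)
    then show "based_subbimodule B star M"
      unfolding based_subbimodule_def R_ad_eq_span_residue using stable[of C] C by blast
  qed
qed

lemma span_eq_zero_iff: "C \<subseteq> B \<Longrightarrow> zmod.span C = {0} \<longleftrightarrow> C = {}"
  using span_eq_iff[of C "{}"] by simp

lemma span_Un_disjoint:
  assumes "C \<subseteq> B" "C' \<subseteq> B" "C \<inter> C' = {}"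
  shows "zmod.span C \<inter> zmod.span C' = {0}"
    and "zmod.span (C \<union> C') = {x + y | x y. x \<in> zmod.span C \<and> y \<in> zmod.span C'}"
proof -
  have "x = 0" if "x \<in> zmod.span C" "x \<in> zmod.span C'" for x
  proof -
    have "supp x \<subseteq> C" "supp x \<subseteq> C'"
      using that in_span_iff_supp[OF assms(1)] in_span_iff_supp[OF assms(2)] by simp_all
    then have "supp x \<subseteq> {}" using assms(3) by blast
    then have "x \<in> zmod.span {}" using in_span_iff_supp[of "{}"] by simp
    then show ?thesis by simp
  qed
  then show "zmod.span C \<inter> zmod.span C' = {0}" using zmod.span_zero by blast
  show "zmod.span (C \<union> C') = {x + y | x y. x \<in> zmod.span C \<and> y \<in> zmod.span C'}"
    unfolding zmod.span_Un by auto
qed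

text \<open>
  Inside the set \<open>C\<close> of basic elements spanning \<open>M\<close>, any coset \<open>K\<close> and its complement \<open>C - K\<close> are
  both stable, so indecomposability leaves no room for the complement.
\<close>

lemma indecomposable_imp_coset:
  assumes "indecomposable_subbimodule B star M"
  obtains x where "x \<in> B" "M = zmod.span {y. same_coset x y}"
proof -
  have "based_subbimodule B star M" "M \<noteq> {0}"
    using assms unfolding indecomposable_subbimodule_def by simp_all
  then obtain C where stable: "residue_stable C" and M: "M = zmod.span C"
    by (auto simp: based_subbimodule_iff)
  have C: "C \<subseteq> B" using stable by (simp add: residue_stable_def)
  then obtain x where x: "x \<in> C" using \<open>M \<noteq> {0}\<close> M span_eq_zero_iff[OF C] by auto
  then have xB: "x \<in> B" using C by blast
  define K where "K = {y. same_coset x y}"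
  have K: "residue_stable K" "K \<subseteq> C" "x \<in> K"
    unfolding K_def using residue_stable_coset[OF xB] stable[unfolded residue_stable_iff] x
      same_coset_refl[OF xB] by auto
  have "C - K = {}"
  proof (rule ccontr)
    assume ne: "C - K \<noteq> {}"
    have KB: "K \<subseteq> B" "C - K \<subseteq> B" using K C by blast+
    have sub: "based_subbimodule B star (zmod.span K)" "based_subbimodule B star (zmod.span (C - K))"
      unfolding based_subbimodule_iff using K(1) residue_stable_diff[OF stable K(1)] by auto
    have ne0: "zmod.span K \<noteq> {0}" "zmod.span (C - K) \<noteq> {0}"
      using K(3) ne by (auto simp: span_eq_zero_iff[OF KB(1)] span_eq_zero_iff[OF KB(2)])
    have "K \<union> (C - K) = C" using K by blast
    then have "zmod.span K \<inter> zmod.span (C - K) = {0}"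
      "M = {x + y | x y. x \<in> zmod.span K \<and> y \<in> zmod.span (C - K)}"
      using span_Un_disjoint[OF KB] M by auto
    then show False
      using assms sub ne0 unfolding indecomposable_subbimodule_def by blast
  qed
  then have "M = zmod.span K" using K M by (simp add: subset_antisym)
  then show thesis using that xB K_def by blast
qed

text \<open>
  If the basic element \<open>b\<close> were in no \<open>C a\<close>, its coefficient would vanish in every component of
  the decomposition of \<open>b\<close>; if it were in two of them, \<open>b\<close> would have two decompositions, each
  concentrated in a single component.
\<close>

lemma direct_sum_basis_unique:
  assumes sum: "is_direct_sum A N" and N: "\<And>a. a \<in> A \<Longrightarrow> C a \<subseteq> B \<and> N a = zmod.span (C a)"
    and b: "b \<in> B"
  shows "\<exists>!a. a \<in> A \<and> b \<in> C a"
proof -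
  define dec where "dec f \<longleftrightarrow> (\<forall>a\<in>A. f a \<in> N a) \<and> (\<forall>a. a \<notin> A \<longrightarrow> f a = 0) \<and>
              finite {a. f a \<noteq> 0} \<and> b = (\<Sum>a | f a \<noteq> 0. f a)" for f
  have ex1: "\<exists>!f. dec f" using sum unfolding is_direct_sum_def dec_def by blast
  have b0: "b \<noteq> 0" using b independent_basis zmod.dependent_zero by blast
  have dec_single: "dec (\<lambda>c. if c = a then b else 0)" if a: "a \<in> A" "b \<in> C a" for a
  proof -
    have "{c. (if c = a then b else 0) \<noteq> 0} = {a}" using b0 by auto
    then show ?thesis
      unfolding dec_def using a N zmod.span_base zmod.span_zero by auto
  qed
  have "\<exists>a. a \<in> A \<and> b \<in> C a"
  proof (rule ccontr)
    assume none: "\<nexists>a. a \<in> A \<and> b \<in> C a"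
    obtain f where f: "dec f" using ex1 by blast
    have "coeff (f a) b = 0" for a
    proof (cases "a \<in> A")
      case True
      then have "supp (f a) \<subseteq> C a" using f N[of a] in_span_iff_supp[of "C a" "f a"] unfolding dec_def by auto
      then show ?thesis using none True unfolding supp_def by blast
    next
      case False
      then show ?thesis using f by (simp add: dec_def zmod.representation_zero)
    qed
    moreover have "coeff b b = (\<Sum>a | f a \<noteq> 0. coeff (f a) b)"
      using f zmod.representation_sum[OF independent_basis in_span_basis, of f "{a. f a \<noteq> 0}"]
      unfolding dec_def by metis
    ultimately show False using coeff_basis[OF b] by simp
  qed
  moreover have "a = a'" if "a \<in> A \<and> b \<in> C a" "a' \<in> A \<and> b \<in> C a'" for a a'
  proof -
    have "(\<lambda>c. if c = a then b else 0) = (\<lambda>c. if c = a' then b else 0)"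
      using ex1 dec_single that by blast
    then show ?thesis using b0 by (metis (mono_tags))
  qed
  ultimately show ?thesis by blast
qed

lemma indecomposable_decomposition_cosets:
  assumes "indecomposable_decomposition B star A R"
  obtains cls where "cls ` B = A"
    "\<And>x y. \<lbrakk>x \<in> B; y \<in> B\<rbrakk> \<Longrightarrow> cls x = cls y \<longleftrightarrow> same_coset x y"
    "\<And>a. a \<in> A \<Longrightarrow> R a = zmod.span {x \<in> B. cls x = a}"
proof -
  have sum: "is_direct_sum A R"
    and ind: "\<And>a. a \<in> A \<Longrightarrow> indecomposable_subbimodule B star (R a)"
    using assms by (auto simp: indecomposable_decomposition_def)
  have "\<forall>a. \<exists>x. a \<in> A \<longrightarrow> x \<in> B \<and> R a = zmod.span {y. same_coset x y}"
    using indecomposable_imp_coset[OF ind] by metis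
  then obtain rep where rep: "\<And>a. a \<in> A \<Longrightarrow> rep a \<in> B"
    "\<And>a. a \<in> A \<Longrightarrow> R a = zmod.span {y. same_coset (rep a) y}" by metis
  define cls where "cls x = (THE a. a \<in> A \<and> same_coset (rep a) x)" for x
  have "\<exists>!a. a \<in> A \<and> x \<in> {y. same_coset (rep a) y}" if "x \<in> B" for x
    by (rule direct_sum_basis_unique[OF sum _ that]) (use rep same_coset_in in blast)
  then have ex1: "\<exists>!a. a \<in> A \<and> same_coset (rep a) x" if "x \<in> B" for x using that by simp
  have cls: "cls x = a \<longleftrightarrow> same_coset (rep a) x" if "x \<in> B" "a \<in> A" for x a
    unfolding cls_def using theI'[OF ex1[OF that(1)]] ex1[OF that(1)] that(2) by blast
  have cls_in: "cls x \<in> A" if "x \<in> B" for x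
    unfolding cls_def using theI'[OF ex1[OF that]] by blast
  show thesis
  proof (rule that)
    have "a \<in> cls ` B" if "a \<in> A" for a
      using cls[OF rep(1)[OF that] that] same_coset_refl[OF rep(1)[OF that]] rep(1)[OF that]
      by (metis imageI)
    then show "cls ` B = A" using cls_in by blast
    show "cls x = cls y \<longleftrightarrow> same_coset x y" if "x \<in> B" "y \<in> B" for x y
      using cls[OF that(1) cls_in[OF that(2)]] cls[OF that(2) cls_in[OF that(2)]]
        same_coset_sym same_coset_trans by blast
    show "R a = zmod.span {x \<in> B. cls x = a}" if a: "a \<in> A" for a
    proof -
      have "x \<in> B \<and> cls x = a \<longleftrightarrow> same_coset (rep a) x" for x
        using cls[of x a] a same_coset_in[of "rep a" x] by blast
      then show ?thesis using rep(2)[OF a] by simp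
    qed
  qed
qed

end

section \<open>The group of components\<close>

theorem theorem3p5:
  fixes B :: "'a::ring_1 set" and star :: "'a \<Rightarrow> 'a"
    and A :: "'i set" and R :: "'i \<Rightarrow> 'a set" and e :: 'i and dual :: "'i \<Rightarrow> 'i"
  assumes "based_ring B star"
    and "indecomposable_decomposition B star A R"
    and "e \<in> A" and "R e = R_ad B star"
    and "\<And>a. a \<in> A \<Longrightarrow> dual a \<in> A"
    and "\<And>a. a \<in> A \<Longrightarrow> R (dual a) = star_ext B star ` R a"
  shows "\<exists>G :: 'i monoid. group G \<and> carrier G = A \<and> mult_by_components R G \<and>
           \<one>\<^bsub>G\<^esub> = e \<and> (\<forall>a\<in>A. inv\<^bsub>G\<^esub> a = dual a) \<and>
           (\<forall>H :: 'i monoid. group H \<longrightarrow> carrier H = A \<longrightarrow> mult_by_components R H \<longrightarrow>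
              (\<forall>a\<in>A. \<forall>b\<in>A. a \<otimes>\<^bsub>H\<^esub> b = a \<otimes>\<^bsub>G\<^esub> b))"
proof -
  interpret based B star by unfold_locales fact
  obtain cls where cls_A: "cls ` B = A"
    and cls_eq: "\<And>x y. \<lbrakk>x \<in> B; y \<in> B\<rbrakk> \<Longrightarrow> cls x = cls y \<longleftrightarrow> same_coset x y"
    and R: "\<And>a. a \<in> A \<Longrightarrow> R a = zmod.span {x \<in> B. cls x = a}"
    using indecomposable_decomposition_cosets[OF assms(2)] by blast
  obtain G :: "'i monoid" where G: "group G" "carrier G = cls ` B" "\<one>\<^bsub>G\<^esub> = cls 1"
    and mulG: "\<And>x y z. \<lbrakk>x \<in> B; y \<in> B; z \<in> supp (x * y)\<rbrakk> \<Longrightarrow> cls x \<otimes>\<^bsub>G\<^esub> cls y = cls z"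
    and invG: "\<And>x. x \<in> B \<Longrightarrow> inv\<^bsub>G\<^esub> (cls x) = cls (star x)"
    by (rule coset_group[OF cls_eq], assumption, assumption, rule that)
  note carrier_G = G(2)[unfolded cls_A]
  have comp: "a \<otimes>\<^bsub>G\<^esub> b = c \<longleftrightarrow> (\<forall>X\<in>R a. \<forall>Y\<in>R b. X * Y \<in> R c)"
    if abc: "a \<in> A" "b \<in> A" "c \<in> A" for a b c
  proof -
    have "(\<forall>X\<in>R a. \<forall>Y\<in>R b. X * Y \<in> R c) \<longleftrightarrow>
        (\<forall>x\<in>{x \<in> B. cls x = a}. \<forall>y\<in>{y \<in> B. cls y = b}. supp (x * y) \<subseteq> {z \<in> B. cls z = c})"
      unfolding R[OF abc(1)] R[OF abc(2)] R[OF abc(3)] by (rule mult_in_span_iff) auto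
    also have "\<dots> \<longleftrightarrow> a \<otimes>\<^bsub>G\<^esub> b = c"
    proof
      assume *: "\<forall>x\<in>{x \<in> B. cls x = a}. \<forall>y\<in>{y \<in> B. cls y = b}. supp (x * y) \<subseteq> {z \<in> B. cls z = c}"
      obtain x y where xy: "x \<in> B" "cls x = a" "y \<in> B" "cls y = b"
        using abc(1,2) unfolding cls_A[symmetric] by blast
      obtain z where z: "z \<in> supp (x * y)" using mul_nonempty[OF xy(1,3)] by blast
      then have "cls z = c" using * xy by blast
      then show "a \<otimes>\<^bsub>G\<^esub> b = c" using mulG[OF xy(1,3) z] xy by simp
    next
      assume ab: "a \<otimes>\<^bsub>G\<^esub> b = c"
      have "z \<in> B \<and> cls z = c" if "x \<in> B" "cls x = a" "y \<in> B" "cls y = b" "z \<in> supp (x * y)" for x y z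
        using mulG[OF that(1,3,5)] mul_in[OF that(1,3,5)] that(2,4) ab by simp
      then show "\<forall>x\<in>{x \<in> B. cls x = a}. \<forall>y\<in>{y \<in> B. cls y = b}. supp (x * y) \<subseteq> {z \<in> B. cls z = c}"
        by blast
    qed
    finally show ?thesis by simp
  qed
  have "{x \<in> B. cls x = e} = residue"
  proof -
    have "zmod.span {x \<in> B. cls x = e} = zmod.span residue"
      using R[OF assms(3)] assms(4) R_ad_eq_span_residue by simp
    then show ?thesis using span_eq_iff[OF _ residue_subset, of "{x \<in> B. cls x = e}"] by auto
  qed
  then have one: "\<one>\<^bsub>G\<^esub> = e" using one_in_residue G(3) by auto
  have inv: "inv\<^bsub>G\<^esub> a = dual a" if a: "a \<in> A" for a
  proof -
    obtain x where x: "x \<in> B" "cls x = a" using a unfolding cls_A[symmetric] by blast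
    then have "x \<in> R a" unfolding R[OF a] by (intro zmod.span_base) simp
    then have "star x \<in> R (dual a)"
      using assms(6)[OF a] star_ext_basis[OF finite_basis independent_basis x(1), of star] by (metis imageI)
    then have "supp (star x) \<subseteq> {x \<in> B. cls x = dual a}"
      using R[OF assms(5)[OF a]] in_span_iff_supp[of "{x \<in> B. cls x = dual a}"] by auto
    then have "cls (star x) = dual a" using supp_basis[OF star_in_basis[OF x(1)]] by simp
    then show ?thesis using invG[OF x(1)] x(2) by simp
  qed
  have "a \<otimes>\<^bsub>H\<^esub> b = a \<otimes>\<^bsub>G\<^esub> b"
    if H: "carrier H = A" "mult_by_components R H" and ab: "a \<in> A" "b \<in> A" for H :: "'i monoid" and a b
  proof -
    have "a \<otimes>\<^bsub>G\<^esub> b \<in> A" using monoid.m_closed[OF group.is_monoid[OF G(1)], of a b] ab carrier_G by simp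
    then show ?thesis using comp[OF ab, of "a \<otimes>\<^bsub>G\<^esub> b"] H ab unfolding mult_by_components_def by simp
  qed
  moreover have "mult_by_components R G" unfolding mult_by_components_def carrier_G using comp by simp
  ultimately show ?thesis using G(1) carrier_G one inv by blast
qed

end
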